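(* (1) Let $\{f_n\}\subset\mathcal{A}_C$ and $f\in\mathcal{A}_C$. If $\|f_n-f\|\to0$ then $\int_{-\infty}^\infty f_n\to\int_{-\infty}^\infty f$. (2) The converse of (1) is false: there are $\{f_n\}\subset\mathcal{A}_C$ and $f\in\mathcal{A}_C$ with $\int_{-\infty}^\infty f_n\to\int_{-\infty}^\infty f$ but $\|f_n-f\|\not\to0$. (3) Let $\{f_n\}\subset\mathcal{A}_C$ and $f\in\mathcal{A}_C$. If $f_n\to f$ weakly in $\mathcal{BV}$ then $\int_{-\infty}^\infty f_n\to\int_{-\infty}^\infty f$. (4) There is a sequence $\{f_n\}\subset\mathcal{A}_C$ and a distribution $f\in\mathcal{A}_C$ such that $f_n\to f$ weakly in $\mathcal{D}$ and $\int_{-\infty}^\infty f_n\not\to\int_{-\infty}^\infty f$. (5) There is a sequence $\{f_n\}\subset\mathcal{A}_C$ that does not converge weakly in $\mathcal{D}$ but $\{\int_{-\infty}^\infty f_n\}$ converges in $\mathbb{R}$.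
   Context: $\mathcal{D}=C_c^\infty(\mathbb{R})$ (real-valued), $\mathcal{D}'$ is the space of distributions, $\langle T',\phi\rangle=-\langle T,\phi'\rangle$; functions are identified with distributions in the usual way. $\overline{\mathbb{R}}=[-\infty,\infty]$. $C^0(\overline{\mathbb{R}})$ is the set of continuous real functions $F$ on $\mathbb{R}$ with real limits at $\pm\infty$, extended by $F(\pm\infty)=\lim_{\pm\infty}F$. $\mathcal{B}_C=\{F\in C^0(\overline{\mathbb{R}}): F(-\infty)=0\}$ and $\mathcal{A}_C=\{f\in\mathcal{D}': f=F' \text{ for some } F\in\mathcal{B}_C\}$; the primitive $F\in\mathcal{B}_C$ of $f$ is unique, $\int_{-\infty}^\infty f=F(\infty)$, and $\|f\|=\|F\|_\infty$ (Alexiewicz norm). $\mathcal{BV}$ is the set of $g:\overline{\mathbb{R}}\to\mathbb{R}$ of bounded variation on $\overline{\mathbb{R}}$. For $f\in\mathcal{A}_C$ with primitive $F$ and $g\in\mathcal{BV}$, $\int_{-\infty}^\infty fg:=F(\infty)g(\infty)-\int_{-\infty}^\infty F\,dg$, where the last integral is the Riemann–Stieltjes integral over $\overline{\mathbb{R}}$ (including contributions of jumps of $g$ at $\pm\infty$): $$\int_{-\infty}^\infty F\,dg=\lim_{A\to-\infty,\,B\to\infty}\int_A^B F\,dg+F(\infty)\bigl[g(\infty)-\lim_{x\to\infty}g(x)\bigr]+F(-\infty)\bigl[\lim_{x\to-\infty}g(x)-g(-\infty)\bigr].$$ For $\{f_n\}\subset\mathcal{A}_C$: $f_n\to f$ weakly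 in $\mathcal{D}$ if $\langle f_n-f,\phi\rangle\to0$ for each $\phi\in\mathcal{D}$ (here $f$ is a distribution); $f_n\to f\in\mathcal{A}_C$ weakly in $\mathcal{BV}$ if $\int_{-\infty}^\infty(f_n-f)g\to0$ for each $g\in\mathcal{BV}$. *)

theory Defs
  imports "HOL-Analysis.Analysis"
begin

section \<open>Test functions\<close>

definition smooth :: "(real \<Rightarrow> real) \<Rightarrow> bool" where
  "smooth \<phi> \<longleftrightarrow> (\<forall>k x. (deriv ^^ k) \<phi> field_differentiable at x)"

definition support :: "(real \<Rightarrow> real) \<Rightarrow> real set" where
  "support \<phi> = closure {x. \<phi> x \<noteq> 0}"

lemma zero_outside_support: "x \<notin> support \<phi> \<Longrightarrow> \<phi> x = 0"
  using closure_subset[of "{x. \<phi> x \<noteq> 0}"] by (auto simp: support_def)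

lemma compact_support_subset:
  assumes "compact K" "support \<phi> \<subseteq> K"
  shows "compact (support \<phi>)"
proof -
  have "compact (support \<phi> \<inter> K)"
    using assms(1) by (intro closed_Int_compact) (auto simp: support_def)
  then show ?thesis
    using assms(2) by (simp add: Int_absorb2)
qed

lemma compact_support_mono:
  assumes "compact (support \<phi>)" "\<And>x. \<phi> x = 0 \<Longrightarrow> \<psi> x = 0"
  shows "compact (support \<psi>)"
proof -
  have "support \<psi> \<subseteq> support \<phi>"
    unfolding support_def using assms(2) by (intro closure_mono) auto
  then show ?thesis
    using assms(1) compact_support_subset by blast
qed

lemma higher_deriv_zero: "(deriv ^^ k) (\<lambda>x. 0) = (\<lambda>x. 0 :: real)"
  by (induction k) auto

lemma higher_deriv_add:
  assumes "smooth f" "smooth g"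
  shows "(deriv ^^ k) (\<lambda>x. f x + g x) = (\<lambda>x. (deriv ^^ k) f x + (deriv ^^ k) g x)"
proof (induction k)
  case (Suc k)
  have "(deriv ^^ Suc k) (\<lambda>x. f x + g x) = deriv (\<lambda>x. (deriv ^^ k) f x + (deriv ^^ k) g x)"
    by (simp add: Suc)
  also have "\<dots> = (\<lambda>x. (deriv ^^ Suc k) f x + (deriv ^^ Suc k) g x)"
    using assms by (auto simp: smooth_def fun_eq_iff)
  finally show ?case .
qed simp

lemma higher_deriv_cmult:
  assumes "smooth f"
  shows "(deriv ^^ k) (\<lambda>x. c * f x) = (\<lambda>x. c * (deriv ^^ k) f x)"
proof (induction k)
  case (Suc k)
  have "(deriv ^^ Suc k) (\<lambda>x. c * f x) = deriv (\<lambda>x. c * (deriv ^^ k) f x)"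
    by (simp add: Suc)
  also have "\<dots> = (\<lambda>x. c * (deriv ^^ Suc k) f x)"
    using assms by (auto simp: smooth_def fun_eq_iff)
  finally show ?case .
qed simp

lemma smooth_zero: "smooth (\<lambda>x. 0)"
  by (simp add: smooth_def higher_deriv_zero)

lemma smooth_add: "smooth f \<Longrightarrow> smooth g \<Longrightarrow> smooth (\<lambda>x. f x + g x)"
  by (subst smooth_def) (auto simp: higher_deriv_add smooth_def intro!: field_differentiable_add)

lemma smooth_cmult: "smooth f \<Longrightarrow> smooth (\<lambda>x. c * f x)"
  by (subst smooth_def) (auto simp: higher_deriv_cmult smooth_def intro!: field_differentiable_mult)

lemma smooth_deriv: "smooth f \<Longrightarrow> smooth (deriv f)"
  unfolding smooth_def
proof (intro allI)
  fix k x
  assume "\<forall>k x. (deriv ^^ k) f field_differentiable at x"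
  then have "(deriv ^^ Suc k) f field_differentiable at x" by blast
  then show "(deriv ^^ k) (deriv f) field_differentiable at x"
    by (simp add: funpow_Suc_right del: funpow.simps)
qed

lemma compact_support_add:
  assumes "compact (support f)" "compact (support g)"
  shows "compact (support (\<lambda>x. f x + g x))"
proof -
  have "support (\<lambda>x. f x + g x) \<subseteq> support f \<union> support g"
    unfolding support_def closure_Un[symmetric] by (intro closure_mono) auto
  moreover have "compact (support f \<union> support g)"
    using assms by (rule compact_Un)
  ultimately show ?thesis
    using compact_support_subset by blast
qed

lemma support_deriv: "support (deriv f) \<subseteq> support f"
proof -
  have "deriv f x = 0" if "x \<notin> support f" for x
  proof -
    have "eventually (\<lambda>y. y \<in> - support f) (nhds x)"
      using that by (intro eventually_nhds_in_open) (auto simp: support_def)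
    then have "eventually (\<lambda>y. f y = (\<lambda>_. 0) y) (nhds x)"
      by eventually_elim (auto intro: zero_outside_support)
    then show ?thesis
      by (subst deriv_cong_ev[where g = "\<lambda>_. 0"]) auto
  qed
  then have "{x. deriv f x \<noteq> 0} \<subseteq> support f"
    by blast
  then show ?thesis
    unfolding support_def[of "deriv f"] by (rule closure_minimal) (simp add: support_def)
qed

lemma compact_support_deriv: "compact (support f) \<Longrightarrow> compact (support (deriv f))"
  using compact_support_subset support_deriv by blast

typedef test_function = "{\<phi> :: real \<Rightarrow> real. smooth \<phi> \<and> compact (support \<phi>)}"
  morphisms tf_apply Abs_test_function
  by (rule exI[of _ "\<lambda>x. 0"]) (simp add: smooth_zero support_def)

setup_lifting type_definition_test_function

instantiation test_function :: real_vector
begin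

lift_definition zero_test_function :: test_function is "\<lambda>x. 0"
  by (simp add: smooth_zero support_def)

lift_definition plus_test_function :: "test_function \<Rightarrow> test_function \<Rightarrow> test_function"
  is "\<lambda>f g x. f x + g x"
  by (simp add: smooth_add compact_support_add)

lift_definition scaleR_test_function :: "real \<Rightarrow> test_function \<Rightarrow> test_function"
  is "\<lambda>c f x. c * f x"
  by (auto simp: smooth_cmult intro: compact_support_mono)

lift_definition uminus_test_function :: "test_function \<Rightarrow> test_function"
  is "\<lambda>f x. - f x"
  using smooth_cmult[where c = "-1"] by (auto intro: compact_support_mono)

lift_definition minus_test_function :: "test_function \<Rightarrow> test_function \<Rightarrow> test_function"
  is "\<lambda>f g x. f x - g x"
proof (intro conjI)
  fix f g
  assume f: "smooth f \<and> compact (support f)" and g: "smooth g \<and> compact (support g)"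
  have "smooth (\<lambda>x. - 1 * g x)"
    using g smooth_cmult by blast
  moreover have "compact (support (\<lambda>x. - 1 * g x))"
    using g by (auto intro: compact_support_mono)
  ultimately show "smooth (\<lambda>x. f x - g x)" "compact (support (\<lambda>x. f x - g x))"
    using f smooth_add[of f "\<lambda>x. - 1 * g x"] compact_support_add[of f "\<lambda>x. - 1 * g x"]
    by auto
qed

instance
  by standard (transfer; simp add: algebra_simps)+

end

lift_definition tf_deriv :: "test_function \<Rightarrow> test_function" is deriv
  by (simp add: smooth_deriv compact_support_deriv)

text \<open>Sequential convergence in the usual inductive limit topology of the test functions.\<close>

definition tf_tendsto :: "(nat \<Rightarrow> test_function) \<Rightarrow> test_function \<Rightarrow> bool" where
  "tf_tendsto \<phi> \<psi> \<longleftrightarrow>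
     (\<exists>K. compact K \<and> (\<forall>n. support (tf_apply (\<phi> n)) \<subseteq> K)) \<and>
     (\<forall>k. uniform_limit UNIV (\<lambda>n. (deriv ^^ k) (tf_apply (\<phi> n)))
            ((deriv ^^ k) (tf_apply \<psi>)) sequentially)"

section \<open>Distributions\<close>

text \<open>On the space of test functions, sequential continuity of a linear functional is equivalent
  to continuity.\<close>

typedef distribution =
  "{T :: test_function \<Rightarrow> real. linear T \<and>
      (\<forall>\<phi> \<psi>. tf_tendsto \<phi> \<psi> \<longrightarrow> (\<lambda>n. T (\<phi> n)) \<longlonglongrightarrow> T \<psi>)}"
  morphisms dist_apply Abs_distribution
  by (rule exI[of _ "\<lambda>_. 0"]) (auto simp: linear_iff)

setup_lifting type_definition_distribution

instantiation distribution :: real_vector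
begin

lift_definition zero_distribution :: distribution is "\<lambda>_. 0"
  by (auto simp: linear_iff)

lift_definition plus_distribution :: "distribution \<Rightarrow> distribution \<Rightarrow> distribution"
  is "\<lambda>S T \<phi>. S \<phi> + T \<phi>"
  by (simp add: linear_compose_add tendsto_add)

lift_definition minus_distribution :: "distribution \<Rightarrow> distribution \<Rightarrow> distribution"
  is "\<lambda>S T \<phi>. S \<phi> - T \<phi>"
  by (simp add: linear_compose_sub tendsto_diff)

lift_definition uminus_distribution :: "distribution \<Rightarrow> distribution"
  is "\<lambda>T \<phi>. - T \<phi>"
  by (simp add: linear_compose_neg tendsto_minus)

lift_definition scaleR_distribution :: "real \<Rightarrow> distribution \<Rightarrow> distribution"
  is "\<lambda>c T \<phi>. c * T \<phi>"
  by (simp add: linear_iff distrib_left mult.left_commute tendsto_mult_left)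

instance
  by standard (transfer; simp add: algebra_simps)+

end

lemma linear_tf_deriv: "linear tf_deriv"
proof (rule linearI)
  show "tf_deriv (f + g) = tf_deriv f + tf_deriv g" for f g
    by transfer (use higher_deriv_add[where k = 1] in simp)
  show "tf_deriv (c *\<^sub>R f) = c *\<^sub>R tf_deriv f" for c f
    by transfer (use higher_deriv_cmult[where k = 1] in simp)
qed

lemma tf_tendsto_deriv:
  assumes "tf_tendsto \<phi> \<psi>"
  shows "tf_tendsto (\<lambda>n. tf_deriv (\<phi> n)) (tf_deriv \<psi>)"
proof -
  have eq: "(deriv ^^ k) (tf_apply (tf_deriv \<theta>)) = (deriv ^^ Suc k) (tf_apply \<theta>)" for k \<theta>
    by (simp add: tf_deriv.rep_eq funpow_Suc_right del: funpow.simps)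
  obtain K where K: "compact K" "\<And>n. support (tf_apply (\<phi> n)) \<subseteq> K"
    using assms unfolding tf_tendsto_def by blast
  have "support (tf_apply (tf_deriv (\<phi> n))) \<subseteq> K" for n
    using support_deriv[of "tf_apply (\<phi> n)"] K(2)[of n] by (auto simp: tf_deriv.rep_eq)
  moreover have "uniform_limit UNIV (\<lambda>n. (deriv ^^ Suc k) (tf_apply (\<phi> n)))
      ((deriv ^^ Suc k) (tf_apply \<psi>)) sequentially" for k
    using assms unfolding tf_tendsto_def by blast
  ultimately show ?thesis
    using K(1) unfolding tf_tendsto_def eq by blast
qed

lift_definition dist_deriv :: "distribution \<Rightarrow> distribution"
  is "\<lambda>T \<phi>. - T (tf_deriv \<phi>)"
  by (simp add: linear_iff linear_add[OF linear_tf_deriv] linear_cmul[OF linear_tf_deriv]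
      tendsto_minus tf_tendsto_deriv)

definition locally_integrable :: "(real \<Rightarrow> real) \<Rightarrow> bool" where
  "locally_integrable F \<longleftrightarrow> (\<forall>K. compact K \<longrightarrow> set_integrable lborel K F)"

lemma continuous_imp_locally_integrable:
  "continuous_on UNIV F \<Longrightarrow> locally_integrable F"
  unfolding locally_integrable_def set_integrable_def real_scaleR_def
proof (intro allI impI)
  fix K :: "real set"
  assume F: "continuous_on UNIV F" and K: "compact K"
  have "continuous_on K F"
    using F by (rule continuous_on_subset) simp
  from borel_integrable_compact[OF K this]
  show "integrable lborel (\<lambda>x. indicator K x * F x)"
    by simp
qed

lemma continuous_on_tf_apply: "continuous_on UNIV (tf_apply \<phi>)"
proof -
  have "tf_apply \<phi> field_differentiable at x" for x
  proof -
    have "(deriv ^^ 0) (tf_apply \<phi>) field_differentiable at x"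
      using tf_apply[of \<phi>] unfolding smooth_def by blast
    then show ?thesis by simp
  qed
  then show ?thesis
    by (simp add: continuous_at_imp_continuous_on field_differentiable_imp_continuous_at)
qed

lemma integrable_mult_tf:
  assumes "locally_integrable F"
  shows "integrable lborel (\<lambda>x. F x * tf_apply \<phi> x)"
proof -
  let ?K = "support (tf_apply \<phi>)"
  have K: "compact ?K"
    using tf_apply[of \<phi>] by simp
  then have "compact (tf_apply \<phi> ` ?K)"
    by (intro compact_continuous_image continuous_on_subset[OF continuous_on_tf_apply]) auto
  then obtain B where "\<forall>y\<in>tf_apply \<phi> ` ?K. norm y \<le> B"
    using compact_imp_bounded bounded_iff by metis
  then have B: "\<bar>tf_apply \<phi> x\<bar> \<le> B" if "x \<in> ?K" for x
    using that by auto
  have F: "integrable lborel (\<lambda>x. indicator ?K x * F x)"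
    using assms K by (simp add: locally_integrable_def set_integrable_def)
  have [measurable]: "tf_apply \<phi> \<in> borel_measurable lborel"
    using borel_measurable_continuous_onI[OF continuous_on_tf_apply] by simp
  have "integrable lborel (\<lambda>x. (indicator ?K x * F x) * tf_apply \<phi> x)"
  proof (rule Bochner_Integration.integrable_bound)
    show "integrable lborel (\<lambda>x. B * (indicator ?K x * F x))"
      using F by simp
    show "(\<lambda>x. (indicator ?K x * F x) * tf_apply \<phi> x) \<in> borel_measurable lborel"
      using borel_measurable_integrable[OF F] by measurable
    have "norm ((indicator ?K x * F x) * tf_apply \<phi> x) \<le> norm (B * (indicator ?K x * F x))" for x
    proof (cases "x \<in> ?K")
      case True
      have "\<bar>F x\<bar> * \<bar>tf_apply \<phi> x\<bar> \<le> \<bar>F x\<bar> * \<bar>B\<bar>"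
        using B[OF True] by (intro mult_left_mono) auto
      with True show ?thesis by (simp add: abs_mult mult.commute)
    qed simp
    then show "AE x in lborel. norm ((indicator ?K x * F x) * tf_apply \<phi> x)
        \<le> norm (B * (indicator ?K x * F x))"
      by simp
  qed
  also have "(\<lambda>x. (indicator ?K x * F x) * tf_apply \<phi> x) = (\<lambda>x. F x * tf_apply \<phi> x)"
    by (auto simp: fun_eq_iff indicator_def intro: zero_outside_support)
  finally show ?thesis .
qed

lemma tendsto_integral_mult_tf:
  assumes F: "locally_integrable F" and conv: "tf_tendsto \<phi> \<psi>"
  shows "(\<lambda>n. LINT x|lborel. F x * tf_apply (\<phi> n) x) \<longlonglongrightarrow> (LINT x|lborel. F x * tf_apply \<psi> x)"
proof -
  obtain K0 where K0: "compact K0" "\<And>n. support (tf_apply (\<phi> n)) \<subseteq> K0"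
    using conv unfolding tf_tendsto_def by blast
  define K where "K = K0 \<union> support (tf_apply \<psi>)"
  have K: "compact K"
    using K0(1) tf_apply[of \<psi>] by (auto simp: K_def intro: compact_Un)
  have FK: "integrable lborel (\<lambda>x. indicator K x * F x)"
    using F K by (simp add: locally_integrable_def set_integrable_def)
  define C where "C = (LINT x|lborel. \<bar>indicator K x * F x\<bar>)"
  have "C \<ge> 0" by (simp add: C_def)
  have unif: "uniform_limit UNIV (\<lambda>n. tf_apply (\<phi> n)) (tf_apply \<psi>) sequentially"
  proof -
    have "uniform_limit UNIV (\<lambda>n. (deriv ^^ 0) (tf_apply (\<phi> n))) ((deriv ^^ 0) (tf_apply \<psi>)) sequentially"
      using conv unfolding tf_tendsto_def by blast
    then show ?thesis by simp
  qed
  show ?thesis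
  proof (rule tendstoI)
    fix e :: real assume "e > 0"
    define d where "d = e / (C + 1)"
    have "d > 0" using \<open>e > 0\<close> \<open>C \<ge> 0\<close> by (simp add: d_def)
    have dC: "C * d < e"
      using \<open>e > 0\<close> \<open>C \<ge> 0\<close> by (simp add: d_def field_simps)
    have "\<forall>\<^sub>F n in sequentially. \<forall>x\<in>UNIV. dist (tf_apply (\<phi> n) x) (tf_apply \<psi> x) < d"
      using unif \<open>d > 0\<close> by (auto simp: uniform_limit_iff)
    then show "\<forall>\<^sub>F n in sequentially.
      dist (LINT x|lborel. F x * tf_apply (\<phi> n) x) (LINT x|lborel. F x * tf_apply \<psi> x) < e"
    proof eventually_elim
      case (elim n)
      note int = integrable_mult_tf[OF F, of "\<phi> n"] integrable_mult_tf[OF F, of \<psi>]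
      have "\<bar>(LINT x|lborel. F x * tf_apply (\<phi> n) x) - (LINT x|lborel. F x * tf_apply \<psi> x)\<bar>
          = \<bar>LINT x|lborel. F x * tf_apply (\<phi> n) x - F x * tf_apply \<psi> x\<bar>"
        using int by simp
      also have "\<dots> \<le> (LINT x|lborel. \<bar>F x * tf_apply (\<phi> n) x - F x * tf_apply \<psi> x\<bar>)"
        by (rule integral_abs_bound)
      also have "\<dots> \<le> (LINT x|lborel. \<bar>indicator K x * F x\<bar> * d)"
      proof (rule integral_mono)
        show "integrable lborel (\<lambda>x. \<bar>F x * tf_apply (\<phi> n) x - F x * tf_apply \<psi> x\<bar>)"
          using int by (intro integrable_abs Bochner_Integration.integrable_diff)
        show "integrable lborel (\<lambda>x. \<bar>indicator K x * F x\<bar> * d)"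
          using FK by (intro integrable_mult_left integrable_abs)
        show "\<bar>F x * tf_apply (\<phi> n) x - F x * tf_apply \<psi> x\<bar> \<le> \<bar>indicator K x * F x\<bar> * d" for x
        proof (cases "x \<in> K")
          case True
          have "\<bar>F x\<bar> * \<bar>tf_apply (\<phi> n) x - tf_apply \<psi> x\<bar> \<le> \<bar>F x\<bar> * d"
            using elim by (intro mult_left_mono) (auto simp: dist_real_def less_imp_le)
          with True show ?thesis
            by (simp add: abs_mult flip: right_diff_distrib)
        next
          case False
          then have "tf_apply (\<phi> n) x = 0" "tf_apply \<psi> x = 0"
            using K0(2)[of n] by (auto simp: K_def intro: zero_outside_support)
          then show ?thesis using \<open>d > 0\<close> by simp
        qed
      qed
      also have "\<dots> = C * d" by (simp add: C_def)
      finally show ?case using dC by (simp add: dist_real_def)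
    qed
  qed
qed

text \<open>The distribution identified with a locally integrable function. The value for other
  functions is a junk value.\<close>

lift_definition dist_of_fun :: "(real \<Rightarrow> real) \<Rightarrow> distribution"
  is "\<lambda>F. if locally_integrable F then (\<lambda>\<phi>. LINT x|lborel. F x * tf_apply \<phi> x) else (\<lambda>_. 0)"
  by (simp add: linear_iff plus_test_function.rep_eq scaleR_test_function.rep_eq
      distrib_left mult.left_commute integrable_mult_tf tendsto_integral_mult_tf)

section \<open>Primitives and the continuous primitive integral\<close>

text \<open>Functions on the extended real line are functions on \<^typ>\<open>ereal\<close>.\<close>

definition C0_ereal :: "(ereal \<Rightarrow> real) set" where
  "C0_ereal = {F. continuous_on UNIV (\<lambda>x::real. F (ereal x)) \<and>
     ((\<lambda>x::real. F (ereal x)) \<longlongrightarrow> F \<infinity>) at_top \<and>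
     ((\<lambda>x::real. F (ereal x)) \<longlongrightarrow> F (-\<infinity>)) at_bot}"

definition B_C :: "(ereal \<Rightarrow> real) set" where
  "B_C = {F \<in> C0_ereal. F (-\<infinity>) = 0}"

definition is_primitive :: "(ereal \<Rightarrow> real) \<Rightarrow> distribution \<Rightarrow> bool" where
  "is_primitive F f \<longleftrightarrow> F \<in> B_C \<and> f = dist_deriv (dist_of_fun (\<lambda>x. F (ereal x)))"

definition A_C :: "distribution set" where
  "A_C = {f. \<exists>F. is_primitive F f}"

text \<open>The primitive in \<^term>\<open>B_C\<close> is unique when it exists, so \<^term>\<open>primitive f\<close> is
  well-defined for \<^prop>\<open>f \<in> A_C\<close>; elsewhere it is a junk value.\<close>

definition primitive :: "distribution \<Rightarrow> ereal \<Rightarrow> real" where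
  "primitive f = (THE F. is_primitive F f)"

definition cp_integral :: "distribution \<Rightarrow> real" where
  "cp_integral f = primitive f \<infinity>"

definition alexiewicz_norm :: "distribution \<Rightarrow> real" where
  "alexiewicz_norm f = (SUP x. \<bar>primitive f x\<bar>)"

section \<open>Functions of bounded variation and the Stieltjes integral\<close>

definition BV :: "(ereal \<Rightarrow> real) set" where
  "BV = {g. \<exists>M. \<forall>n (x :: nat \<Rightarrow> ereal). (\<forall>i<n. x i \<le> x (Suc i)) \<longrightarrow>
     (\<Sum>i<n. \<bar>g (x (Suc i)) - g (x i)\<bar>) \<le> M}"

text \<open>Norm (mesh) convergence of the Riemann--Stieltjes sums over the partitions
  \<^term>\<open>x\<close> of the interval from \<^term>\<open>a\<close> to \<^term>\<open>b\<close> with tags \<^term>\<open>t\<close>.\<close>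

definition has_RS_integral ::
  "(real \<Rightarrow> real) \<Rightarrow> (real \<Rightarrow> real) \<Rightarrow> real \<Rightarrow> real \<Rightarrow> real \<Rightarrow> bool" where
  "has_RS_integral F g a b I \<longleftrightarrow>
     (\<forall>e>0. \<exists>d>0. \<forall>n x t.
        x 0 = a \<and> x n = b \<and>
        (\<forall>i<n. x i \<le> x (Suc i) \<and> x (Suc i) - x i < d \<and> t i \<in> {x i..x (Suc i)}) \<longrightarrow>
        \<bar>(\<Sum>i<n. F (t i) * (g (x (Suc i)) - g (x i))) - I\<bar> < e)"

definition RS_integral :: "(real \<Rightarrow> real) \<Rightarrow> (real \<Rightarrow> real) \<Rightarrow> real \<Rightarrow> real \<Rightarrow> real" where
  "RS_integral F g a b = (THE I. has_RS_integral F g a b I)"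

text \<open>The last two summands are the contributions of the jumps of \<^term>\<open>g\<close> at the infinite
  end points. All the limits and Stieltjes integrals exist for \<^prop>\<open>F \<in> C0_ereal\<close> and
  \<^prop>\<open>g \<in> BV\<close>.\<close>

definition RS_integral_ereal :: "(ereal \<Rightarrow> real) \<Rightarrow> (ereal \<Rightarrow> real) \<Rightarrow> real" where
  "RS_integral_ereal F g =
     Lim (at_bot \<times>\<^sub>F at_top) (\<lambda>(A, B). RS_integral (\<lambda>x. F (ereal x)) (\<lambda>x. g (ereal x)) A B)
     + F \<infinity> * (g \<infinity> - Lim at_top (\<lambda>x::real. g (ereal x)))
     + F (-\<infinity>) * (Lim at_bot (\<lambda>x::real. g (ereal x)) - g (-\<infinity>))"

definition cp_integral_mult :: "distribution \<Rightarrow> (ereal \<Rightarrow> real) \<Rightarrow> real" where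
  "cp_integral_mult f g = primitive f \<infinity> * g \<infinity> - RS_integral_ereal (primitive f) g"

section \<open>Weak convergence\<close>

definition weakly_tendsto_D :: "(nat \<Rightarrow> distribution) \<Rightarrow> distribution \<Rightarrow> bool" where
  "weakly_tendsto_D f f' \<longleftrightarrow> (\<forall>\<phi>. (\<lambda>n. dist_apply (f n - f') \<phi>) \<longlonglongrightarrow> 0)"

definition weakly_tendsto_BV :: "(nat \<Rightarrow> distribution) \<Rightarrow> distribution \<Rightarrow> bool" where
  "weakly_tendsto_BV f f' \<longleftrightarrow> (\<forall>g\<in>BV. (\<lambda>n. cp_integral_mult (f n - f') g) \<longlonglongrightarrow> 0)"

end

theory Submission
  imports Defs
begin

text \<open>Everything rests on the uniqueness of primitives. If the distributional derivative of \<open>F\<close>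
  vanishes, then \<open>F\<close> has the same averages against a smooth bump scaled down to \<open>a\<close> and to \<open>b\<close>,
  hence \<open>F a = F b\<close>. So the primitive is linear in \<open>f\<close>, and the integral of \<open>f\<close>, being the value
  of the primitive at \<open>\<infinity>\<close>, is bounded by the Alexiewicz norm. It is also the integral of \<open>f\<close>
  against the constant 1, a function of bounded variation. For the
  counterexamples, take the derivative of a tent (constant sequence, or multiplied by \<open>n\<close>), which
  has integral 0, and that of a unit ramp running off to \<open>\<infinity>\<close>, which has integral 1.\<close>

section \<open>A smooth bump function\<close>

lemma smooth_differentiable: "smooth f \<Longrightarrow> f field_differentiable at x"
  by (metis smooth_def funpow_0)

text \<open>Iterating \<open>deriv\<close> never leaves \<open>S\<close>, so every iterate is
  differentiable. Each smoothness proof below thus reduces to choosing a class stable under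
  differentiation, with no formula for the k-th derivative.\<close>

lemma smooth_coinduct:
  assumes "f \<in> S" and "\<And>f x. f \<in> S \<Longrightarrow> f field_differentiable at x" "\<And>f. f \<in> S \<Longrightarrow> deriv f \<in> S"
  shows "smooth f"
proof -
  have "(deriv ^^ k) f \<in> S" for k
    by (induction k) (use assms in auto)
  then show ?thesis
    using assms(2) by (simp add: smooth_def)
qed

lemma smooth_antiderivative:
  assumes "\<And>x. (F has_real_derivative f x) (at x)" "smooth f"
  shows "smooth F"
proof (rule smooth_coinduct[of _ "insert F {f. smooth f}"])
  have "deriv F = f"
    using assms(1) by (auto simp: fun_eq_iff intro: DERIV_imp_deriv)
  then show "deriv g \<in> insert F {f. smooth f}" if "g \<in> insert F {f. smooth f}" for g
    using that assms(2) smooth_deriv by auto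
  show "g field_differentiable at x" if "g \<in> insert F {f. smooth f}" for g x
    using that assms(1) smooth_differentiable by (auto simp: field_differentiable_def)
qed simp

text \<open>The product rule turns one product into a sum of two, so closing the products under
  addition is what makes the class stable under differentiation.\<close>

inductive_set product_sums :: "(real \<Rightarrow> real) set" where
  prod: "smooth f \<Longrightarrow> smooth g \<Longrightarrow> (\<lambda>x. f x * g x) \<in> product_sums"
| add: "u \<in> product_sums \<Longrightarrow> v \<in> product_sums \<Longrightarrow> (\<lambda>x. u x + v x) \<in> product_sums"

lemma product_sums_deriv:
  assumes "u \<in> product_sums"
  shows "(\<forall>x. u field_differentiable at x) \<and> deriv u \<in> product_sums"
  using assms
proof induction
  case (prod f g)
  have d: "f field_differentiable at x" "g field_differentiable at x" for x
    using prod smooth_differentiable by auto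
  have "deriv (\<lambda>x. f x * g x) = (\<lambda>x. f x * deriv g x + deriv f x * g x)"
    using d by (auto simp: fun_eq_iff)
  moreover have "(\<lambda>x. f x * deriv g x + deriv f x * g x) \<in> product_sums"
    using prod by (intro product_sums.intros smooth_deriv)
  ultimately show ?case
    using d by (auto intro: field_differentiable_mult)
next
  case (add u v)
  have "deriv (\<lambda>x. u x + v x) = (\<lambda>x. deriv u x + deriv v x)"
    using add.IH by (auto simp: fun_eq_iff)
  then show ?case
    using add.IH by (auto intro: field_differentiable_add product_sums.add)
qed

lemma smooth_mult: "smooth f \<Longrightarrow> smooth g \<Longrightarrow> smooth (\<lambda>x. f x * g x)"
  by (rule smooth_coinduct[of _ product_sums]) (auto intro: product_sums.prod dest: product_sums_deriv)

text \<open>The chain rule releases a factor \<open>c\<close> at each differentiation; the invariant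
  class therefore carries an arbitrary scalar \<open>b\<close> in front.\<close>

lemma smooth_affine:
  assumes "smooth f"
  shows "smooth (\<lambda>x. f (c * x + d))"
proof (rule smooth_coinduct[of _ "{\<lambda>x. b * g (c * x + d) | b g. smooth g}"])
  show "(\<lambda>x. f (c * x + d)) \<in> {\<lambda>x. b * g (c * x + d) | b g. smooth g}"
    using assms by (auto intro!: exI[of _ 1] exI[of _ f])
  fix u assume "u \<in> {\<lambda>x. b * g (c * x + d) | b g. smooth g}"
  then obtain b g where u: "u = (\<lambda>x. b * g (c * x + d))" and g: "smooth g"
    by blast
  have D: "(u has_real_derivative (b * c) * deriv g (c * x + d)) (at x)" for x
  proof -
    have "(g has_real_derivative deriv g (c * x + d)) (at (c * x + d))"
      using smooth_differentiable[OF g] by (simp add: DERIV_deriv_iff_field_differentiable)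
    then show ?thesis
      unfolding u by (auto intro!: derivative_eq_intros DERIV_chain2[where f = g])
  qed
  then show "u field_differentiable at x" for x
    by (auto simp: field_differentiable_def)
  have "deriv u = (\<lambda>x. (b * c) * deriv g (c * x + d))"
    using D by (auto simp: fun_eq_iff intro: DERIV_imp_deriv)
  then show "deriv u \<in> {\<lambda>x. b * g (c * x + d) | b g. smooth g}"
    using smooth_deriv[OF g] by blast
qed

section \<open>Functions flat at the origin\<close>

text \<open>For \<open>p = 1\<close> this is the classical flat function. The polynomial in
  \<open>1 / x\<close> makes room for all its derivatives at once.\<close>

definition exp_inverse_poly :: "real poly \<Rightarrow> real \<Rightarrow> real" where
  "exp_inverse_poly p x = (if x > 0 then poly p (1 / x) * exp (- 1 / x) else 0)"

lemma tendsto_poly_exp_minus: "((\<lambda>y. poly p y * exp (- y)) \<longlongrightarrow> (0 :: real)) at_top"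
proof -
  have "((\<lambda>y. \<Sum>i\<le>degree p. coeff p i * (y ^ i / exp y)) \<longlongrightarrow> (\<Sum>i\<le>degree p. coeff p i * 0)) at_top"
    by (intro tendsto_sum tendsto_mult tendsto_const tendsto_power_div_exp_0)
  then show ?thesis
    by (simp add: poly_altdef sum_distrib_right exp_minus divide_inverse mult.assoc)
qed

text \<open>In the variable y = 1/x one has d/dx = -y^2 d/dy, and applying this to p(y) e^(-y) gives
  y^2 (p - p')(y) e^(-y). Only the origin needs a limit argument.\<close>

lemma exp_inverse_poly_has_derivative:
  "(exp_inverse_poly p has_real_derivative
    exp_inverse_poly (monom 1 2 * (p - pderiv p)) x) (at x)"
proof -
  consider "x > 0" | "x < 0" | "x = 0" by linarith
  then show ?thesis
  proof cases
    case 1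
    have "((\<lambda>x. poly p (1 / x) * exp (- 1 / x)) has_real_derivative
        exp_inverse_poly (monom 1 2 * (p - pderiv p)) x) (at x)"
      using 1 by (auto intro!: derivative_eq_intros DERIV_chain2[OF poly_DERIV]
          simp: exp_inverse_poly_def poly_monom field_simps power2_eq_square)
    moreover have "eventually (\<lambda>y. y \<in> {0<..}) (nhds x)"
      using 1 by (intro eventually_nhds_in_open) auto
    then have "eventually (\<lambda>y. exp_inverse_poly p y = poly p (1 / y) * exp (- 1 / y)) (nhds x)"
      by eventually_elim (simp add: exp_inverse_poly_def)
    ultimately show ?thesis
      by (subst DERIV_cong_ev[OF refl _ refl])
  next
    case 2
    have "eventually (\<lambda>y. y \<in> {..<0}) (nhds x)"
      using 2 by (intro eventually_nhds_in_open) auto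
    then have "eventually (\<lambda>y. exp_inverse_poly p y = 0) (nhds x)"
      by eventually_elim (simp add: exp_inverse_poly_def)
    then show ?thesis
      using 2 by (subst DERIV_cong_ev[OF refl _ refl, where g = "\<lambda>_. 0"])
        (auto simp: exp_inverse_poly_def)
  next
    case 3
    let ?q = "\<lambda>h. exp_inverse_poly p h / h"
    \<comment> \<open>Dividing by h multiplies by y = 1/h, which is the shift from \<open>p\<close>
      to \<open>pCons 0 p\<close>; the exponential beats this polynomial as y grows. On the left the
      quotient is identically 0.\<close>
    have "((\<lambda>h. poly (pCons 0 p) (inverse h) * exp (- inverse h)) \<longlongrightarrow> 0) (at_right 0)"
      by (rule filterlim_compose[OF tendsto_poly_exp_minus filterlim_inverse_at_top_right])
    moreover have "eventually (\<lambda>h. poly (pCons 0 p) (inverse h) * exp (- inverse h) = ?q h) (at_right 0)"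
      using eventually_at_right_less[of 0]
      by eventually_elim (simp add: exp_inverse_poly_def field_simps)
    ultimately have "(?q \<longlongrightarrow> 0) (at_right 0)"
      by (rule Lim_transform_eventually)
    moreover have "(?q \<longlongrightarrow> 0) (at_left 0)"
      by (rule tendsto_eventually)
        (auto simp: exp_inverse_poly_def eventually_at_filter)
    ultimately have "(?q \<longlongrightarrow> 0) (at 0)"
      by (simp add: filterlim_split_at_real)
    then show ?thesis
      using 3 by (simp add: DERIV_def exp_inverse_poly_def)
  qed
qed

lemma smooth_exp_inverse_poly: "smooth (exp_inverse_poly p)"
proof (rule smooth_coinduct[of _ "range exp_inverse_poly"])
  fix f assume "f \<in> range exp_inverse_poly"
  then obtain q where f: "f = exp_inverse_poly q" by blast
  show "f field_differentiable at x" for x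
    unfolding f field_differentiable_def using exp_inverse_poly_has_derivative by blast
  have "deriv f = exp_inverse_poly (monom 1 2 * (q - pderiv q))"
    unfolding f by (intro ext DERIV_imp_deriv exp_inverse_poly_has_derivative)
  then show "deriv f \<in> range exp_inverse_poly" by blast
qed simp

section \<open>The bump, its integral and its antiderivative\<close>

definition bump :: "real \<Rightarrow> real" where
  "bump x = exp_inverse_poly 1 x * exp_inverse_poly 1 (1 - x)"

lemma bump_pos: "0 < x \<Longrightarrow> x < 1 \<Longrightarrow> bump x > 0"
  by (simp add: bump_def exp_inverse_poly_def)

lemma bump_zero: "x \<le> 0 \<or> x \<ge> 1 \<Longrightarrow> bump x = 0"
  by (auto simp: bump_def exp_inverse_poly_def)

lemma smooth_bump: "smooth bump"
  using smooth_mult[OF smooth_exp_inverse_poly[of 1]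
      smooth_affine[OF smooth_exp_inverse_poly[of 1], of "-1" 1]]
  by (simp add: bump_def[abs_def] algebra_simps)

lemma continuous_bump: "continuous_on UNIV bump"
  by (simp add: continuous_at_imp_continuous_on field_differentiable_imp_continuous_at
      smooth_differentiable[OF smooth_bump])

text \<open>A single antiderivative \<open>H\<close> on the whole line serves all three claims: the
  fundamental theorem on the unit interval gives the integral \<open>H 1 - H 0\<close>, and the mean
  value theorem gives its positivity and the constancy of \<open>H\<close> on either side of that
  interval.\<close>

lemma integrable_bump: "integrable lborel bump"
  and integral_bump_pos: "(LINT x|lborel. bump x) > 0"
  and bump_antiderivative:
    "\<exists>H. (\<forall>x. (H has_real_derivative bump x) (at x)) \<and> (\<forall>x\<le>0. H x = H 0) \<and> (\<forall>x\<ge>1. H x = H 1)"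
proof -
  have ind: "(\<lambda>x. bump x * indicator {0..1} x) = bump"
  proof
    show "bump x * indicator {0..1} x = bump x" for x
      using bump_zero[of x] by (cases "x \<in> {0..1}") auto
  qed
  have cont: "isCont bump x" for x
    using continuous_bump by (simp add: continuous_on_eq_continuous_at)
  then obtain H where "\<And>x. (H has_vector_derivative bump x) (at x)"
    using einterval_antiderivative[of "-\<infinity>" "\<infinity>" bump] by auto
  then have H: "(H has_real_derivative bump x) (at x)" for x
    by (simp add: has_real_derivative_iff_has_vector_derivative)
  have "has_bochner_integral lborel (\<lambda>x. bump x * indicator {0..1} x) (H 1 - H 0)"
    by (rule has_bochner_integral_FTC_Icc_real) (use H cont in auto)
  then have int: "has_bochner_integral lborel bump (H 1 - H 0)"
    by (simp add: ind)
  then show "integrable lborel bump"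
    by (simp add: has_bochner_integral_iff)
  obtain z where "0 < z" "z < 1" "H 1 - H 0 = (1 - 0) * bump z"
    using MVT2[of 0 1 H bump] H by auto
  then show "(LINT x|lborel. bump x) > 0"
    using has_bochner_integral_integral_eq[OF int] bump_pos by simp
  have "H x = H 0" if "x \<le> 0" for x
  proof (cases "x = 0")
    case False
    then obtain z where "z < 0" "H 0 - H x = (0 - x) * bump z"
      using MVT2[of x 0 H bump] H \<open>x \<le> 0\<close> by auto
    then show ?thesis
      using bump_zero[of z] by simp
  qed simp
  moreover have "H x = H 1" if "x \<ge> 1" for x
  proof (cases "x = 1")
    case False
    then obtain z where "z > 1" "H x - H 1 = (x - 1) * bump z"
      using MVT2[of 1 x H bump] H \<open>x \<ge> 1\<close> by auto
    then show ?thesis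
      using bump_zero[of z] by simp
  qed simp
  ultimately show "\<exists>H. (\<forall>x. (H has_real_derivative bump x) (at x)) \<and> (\<forall>x\<le>0. H x = H 0) \<and> (\<forall>x\<ge>1. H x = H 1)"
    using H by blast
qed

section \<open>Uniqueness of primitives\<close>

text \<open>Near either end \<open>F\<close> is within 1 of its limit, and between these ends it is
  continuous on a compact interval. The bound supplies the dominating functions used below.\<close>

lemma C0_ereal_bounded:
  assumes "F \<in> C0_ereal"
  shows "\<exists>M. \<forall>x. \<bar>F x\<bar> \<le> M"
proof -
  have cont: "continuous_on UNIV (\<lambda>x::real. F (ereal x))"
    and top: "((\<lambda>x::real. F (ereal x)) \<longlongrightarrow> F \<infinity>) at_top"
    and bot: "((\<lambda>x::real. F (ereal x)) \<longlongrightarrow> F (-\<infinity>)) at_bot"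
    using assms by (auto simp: C0_ereal_def)
  obtain B where B: "\<And>x. x \<ge> B \<Longrightarrow> \<bar>F (ereal x) - F \<infinity>\<bar> < 1"
    using tendstoD[OF top, of 1] by (auto simp: dist_real_def eventually_at_top_linorder)
  obtain A where A: "\<And>x. x \<le> A \<Longrightarrow> \<bar>F (ereal x) - F (-\<infinity>)\<bar> < 1"
    using tendstoD[OF bot, of 1] by (auto simp: dist_real_def eventually_at_bot_linorder)
  have "compact ((\<lambda>x::real. F (ereal x)) ` {A..B})"
    using cont by (intro compact_continuous_image) (auto intro: continuous_on_subset)
  then have "bounded ((\<lambda>x::real. F (ereal x)) ` {A..B})"
    by (rule compact_imp_bounded)
  then obtain C where C: "\<And>x. A \<le> x \<Longrightarrow> x \<le> B \<Longrightarrow> \<bar>F (ereal x)\<bar> \<le> C"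
    unfolding bounded_iff by (metis atLeastAtMost_iff imageI real_norm_def)
  \<comment> \<open>The interval from \<open>A\<close> to \<open>B\<close> may be empty, so
    \<open>C\<close> may be negative; its absolute value keeps the bound valid.\<close>
  have "\<bar>F x\<bar> \<le> \<bar>C\<bar> + \<bar>F \<infinity>\<bar> + \<bar>F (-\<infinity>)\<bar> + 1" for x
  proof (cases x)
    case (real r)
    then show ?thesis
      using A[of r] B[of r] C[of r] by (cases "r \<le> A"; cases "r \<ge> B") auto
  qed auto
  then show ?thesis by blast
qed

lemma locally_integrable_C0_ereal: "F \<in> C0_ereal \<Longrightarrow> locally_integrable (\<lambda>x. F (ereal x))"
  by (auto simp: C0_ereal_def intro: continuous_imp_locally_integrable)

lemma dist_apply_deriv_fun:
  assumes "F \<in> C0_ereal"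
  shows "dist_apply (dist_deriv (dist_of_fun (\<lambda>x. F (ereal x)))) \<phi>
    = - (LINT x|lborel. F (ereal x) * deriv (tf_apply \<phi>) x)"
  using locally_integrable_C0_ereal[OF assms]
  by (simp add: dist_deriv.rep_eq dist_of_fun.rep_eq tf_deriv.rep_eq)

text \<open>Test against the difference of two rescaled copies of an antiderivative of the bump: it has
  compact support, and its derivative is the difference of two rescaled bumps, at \<open>a\<close> and \<open>b\<close>.\<close>

lemma integral_bump_eq_of_deriv_zero:
  assumes F: "F \<in> C0_ereal" and zero: "dist_deriv (dist_of_fun (\<lambda>x. F (ereal x))) = 0"
    and e: "e > 0"
  shows "(LINT y|lborel. F (ereal (a + e * y)) * bump y) = (LINT y|lborel. F (ereal (b + e * y)) * bump y)"
proof -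
  obtain H where H: "\<And>x. (H has_real_derivative bump x) (at x)"
      and H0: "\<And>x. x \<le> 0 \<Longrightarrow> H x = H 0" and H1: "\<And>x. x \<ge> 1 \<Longrightarrow> H x = H 1"
    using bump_antiderivative by blast
  have smH: "smooth H"
    using H smooth_bump by (rule smooth_antiderivative)
  define \<phi> where "\<phi> x = H ((x - a) / e) - H ((x - b) / e)" for x
  have aff: "(x - c) / e = (1 / e) * x + (- c / e)" for x c
    by (simp add: diff_divide_distrib)
  have "smooth (\<lambda>x. H ((x - a) / e) + (- 1) * H ((x - b) / e))"
    unfolding aff by (intro smooth_add smooth_cmult smooth_affine smH)
  then have smooth: "smooth \<phi>"
    by (simp add: \<phi>_def[abs_def])
  \<comment> \<open>To the left both terms of \<open>\<phi>\<close> equal \<open>H 0\<close>, to the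
    right both equal \<open>H 1\<close>, so they cancel, although neither term alone has compact
    support.\<close>
  have "\<phi> x = 0" if "x \<notin> {min a b..max a b + e}" for x
  proof (cases "x < min a b")
    case True
    then have "(x - a) / e \<le> 0" "(x - b) / e \<le> 0"
      using e by (auto simp: field_simps)
    then show ?thesis
      using H0[of "(x - a) / e"] H0[of "(x - b) / e"] by (simp add: \<phi>_def)
  next
    case False
    then have "(x - a) / e \<ge> 1" "(x - b) / e \<ge> 1"
      using e that by (auto simp: field_simps)
    then show ?thesis
      using H1[of "(x - a) / e"] H1[of "(x - b) / e"] by (simp add: \<phi>_def)
  qed
  then have "{x. \<phi> x \<noteq> 0} \<subseteq> {min a b..max a b + e}"
    by blast
  then have "support \<phi> \<subseteq> {min a b..max a b + e}"
    unfolding support_def by (intro closure_minimal) auto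
  then have "compact (support \<phi>)"
    using compact_support_subset compact_Icc by blast
  then have app: "tf_apply (Abs_test_function \<phi>) = \<phi>"
    using smooth by (simp add: Abs_test_function_inverse)
  have d: "deriv \<phi> x = bump ((x - a) / e) / e - bump ((x - b) / e) / e" for x
    unfolding \<phi>_def[abs_def] using e
    by (intro DERIV_imp_deriv) (auto intro!: derivative_eq_intros DERIV_chain2[OF H])
  obtain M where M: "\<And>x. \<bar>F x\<bar> \<le> M"
    using C0_ereal_bounded[OF F] by blast
  have [measurable]: "(\<lambda>x. F (ereal x)) \<in> borel_measurable borel"
    using F by (intro borel_measurable_continuous_onI) (simp add: C0_ereal_def)
  have [measurable]: "bump \<in> borel_measurable borel"
    using continuous_bump by (rule borel_measurable_continuous_onI)
  have int: "integrable lborel (\<lambda>y. F (ereal (c + e * y)) * bump y)" for c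
  proof (rule Bochner_Integration.integrable_bound)
    show "integrable lborel (\<lambda>y. M * bump y)"
      using integrable_bump by simp
    have "norm (F (ereal (c + e * y)) * bump y) \<le> norm (M * bump y)" for y
      unfolding norm_mult using M[of "ereal (c + e * y)"] by (intro mult_right_mono) auto
    then show "AE y in lborel. norm (F (ereal (c + e * y)) * bump y) \<le> norm (M * bump y)"
      by simp
    have "(\<lambda>y. F (ereal (c + e * y))) \<in> borel_measurable lborel"
      by (rule measurable_compose[where f = "\<lambda>y. c + e * y" and g = "\<lambda>x. F (ereal x)" and N = borel])
        auto
    then show "(\<lambda>y. F (ereal (c + e * y)) * bump y) \<in> borel_measurable lborel"
      by measurable
  qed
  have hb: "has_bochner_integral lborel (\<lambda>x. F (ereal x) * (bump ((x - c) / e) / e))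
      (LINT y|lborel. F (ereal (c + e * y)) * bump y)" for c
  proof -
    \<comment> \<open>Substitution x = c + e y: the factor \<open>inverse e\<close> from the
      rescaled bump matches the Jacobian, so the averages at every scale carry the same weight
      \<open>bump\<close>.\<close>
    have "has_bochner_integral lborel (\<lambda>y. F (ereal (c + e * y)) * bump y * inverse e)
        ((LINT y|lborel. F (ereal (c + e * y)) * bump y) * inverse e)"
      by (intro has_bochner_integral_mult_left has_bochner_integral_integrable int)
    then have "has_bochner_integral lborel
        (\<lambda>y. F (ereal (c + e * y)) * (bump ((c + e * y - c) / e) / e))
        ((LINT y|lborel. F (ereal (c + e * y)) * bump y) /\<^sub>R \<bar>e\<bar>)"
      using e by (simp add: divide_inverse mult_ac)
    then show ?thesis
      using e by (subst lborel_has_bochner_integral_real_affine_iff[of e _ _ c]) auto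
  qed
  have "0 = dist_apply (dist_deriv (dist_of_fun (\<lambda>x. F (ereal x)))) (Abs_test_function \<phi>)"
    by (simp add: zero zero_distribution.rep_eq)
  also have "\<dots> = - (LINT x|lborel. F (ereal x) * (bump ((x - a) / e) / e) - F (ereal x) * (bump ((x - b) / e) / e))"
    by (simp only: dist_apply_deriv_fun[OF F] app d right_diff_distrib)
  also have "\<dots> = - ((LINT y|lborel. F (ereal (a + e * y)) * bump y) - (LINT y|lborel. F (ereal (b + e * y)) * bump y))"
    using has_bochner_integral_diff[OF hb[of a] hb[of b]] by (simp only: has_bochner_integral_iff)
  finally show ?thesis by simp
qed

text \<open>As the scale shrinks, dominated convergence and continuity turn the averages around
  \<open>c\<close> into F(c) times the integral of the bump. The averages around \<open>a\<close>
  and \<open>b\<close> agree at each scale, and the bump integral is positive, so it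
  cancels.\<close>

lemma deriv_zero_imp_constant:
  assumes F: "F \<in> C0_ereal" and zero: "dist_deriv (dist_of_fun (\<lambda>x. F (ereal x))) = 0"
  shows "F (ereal a) = F (ereal b)"
proof -
  define e where "e n = 1 / real (Suc n)" for n
  obtain M where M: "\<And>x. \<bar>F x\<bar> \<le> M"
    using C0_ereal_bounded[OF F] by blast
  have [measurable]: "(\<lambda>x. F (ereal x)) \<in> borel_measurable borel"
    using F by (intro borel_measurable_continuous_onI) (simp add: C0_ereal_def)
  have [measurable]: "bump \<in> borel_measurable borel"
    using continuous_bump by (rule borel_measurable_continuous_onI)
  have lim: "(\<lambda>n. LINT y|lborel. F (ereal (c + e n * y)) * bump y) \<longlonglongrightarrow> (LINT y|lborel. F (ereal c) * bump y)" for c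
  proof (rule integral_dominated_convergence[where w = "\<lambda>y. M * \<bar>bump y\<bar>"])
    show "integrable lborel (\<lambda>y. M * \<bar>bump y\<bar>)"
      using integrable_bump by simp
    have "norm (F (ereal (c + e n * y)) * bump y) \<le> M * \<bar>bump y\<bar>" for y n
      unfolding norm_mult using M[of "ereal (c + e n * y)"] by (auto intro: mult_right_mono)
    then show "AE y in lborel. norm (F (ereal (c + e n * y)) * bump y) \<le> M * \<bar>bump y\<bar>" for n
      by simp
    have "(\<lambda>y. F (ereal (c + e n * y))) \<in> borel_measurable lborel" for n
      by (rule measurable_compose[where f = "\<lambda>y. c + e n * y" and g = "\<lambda>x. F (ereal x)" and N = borel])
        auto
    then show "(\<lambda>y. F (ereal (c + e n * y)) * bump y) \<in> borel_measurable lborel" for n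
      by measurable
    have "(\<lambda>n. F (ereal (c + e n * y)) * bump y) \<longlonglongrightarrow> F (ereal c) * bump y" for y
    proof -
      have "e \<longlonglongrightarrow> 0"
        unfolding e_def by (rule lim_1_over_n[THEN LIMSEQ_Suc])
      then have "(\<lambda>n. c + e n * y) \<longlonglongrightarrow> c + 0 * y"
        by (intro tendsto_intros)
      then have "(\<lambda>n. F (ereal (c + e n * y))) \<longlonglongrightarrow> F (ereal c)"
        using F by (intro continuous_on_tendsto_compose[of UNIV "\<lambda>x. F (ereal x)"]) (auto simp: C0_ereal_def)
      then show ?thesis by (rule tendsto_mult_right)
    qed
    then show "AE y in lborel. (\<lambda>n. F (ereal (c + e n * y)) * bump y) \<longlonglongrightarrow> F (ereal c) * bump y"
      by simp
  qed simp
  have "(LINT y|lborel. F (ereal (a + e n * y)) * bump y) = (LINT y|lborel. F (ereal (b + e n * y)) * bump y)" for n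
    by (rule integral_bump_eq_of_deriv_zero[OF F zero]) (simp add: e_def)
  then have "(LINT y|lborel. F (ereal a) * bump y) = (LINT y|lborel. F (ereal b) * bump y)"
    using LIMSEQ_unique[OF lim[of a]] lim[of b] by simp
  then show ?thesis
    using integral_bump_pos by simp
qed

text \<open>Constancy on the reals passes to both infinite points as limits, and the normalisation
  at \<open>-\<infinity>\<close> fixes the constant to be 0.\<close>

lemma is_primitive_zero_imp:
  assumes "is_primitive F 0"
  shows "F x = 0"
proof -
  have F: "F \<in> C0_ereal" and bot: "F (-\<infinity>) = 0"
    and zero: "dist_deriv (dist_of_fun (\<lambda>x. F (ereal x))) = 0"
    using assms by (auto simp: is_primitive_def B_C_def)
  have const: "F (ereal r) = F (ereal 0)" for r
    by (rule deriv_zero_imp_constant[OF F zero])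
  have lims: "((\<lambda>r::real. F (ereal r)) \<longlongrightarrow> F \<infinity>) at_top" "((\<lambda>r::real. F (ereal r)) \<longlongrightarrow> F (-\<infinity>)) at_bot"
    using F by (auto simp: C0_ereal_def)
  moreover have "(\<lambda>r. F (ereal r)) = (\<lambda>_. F (ereal 0))"
    using const by (rule ext)
  ultimately have "F \<infinity> = F (ereal 0)" "F (-\<infinity>) = F (ereal 0)"
    by (metis tendsto_const_iff trivial_limit_at_top_linorder,
        metis tendsto_const_iff trivial_limit_at_bot_linorder)
  then show ?thesis
    using bot const by (cases x) metis+
qed

section \<open>Primitives of differences and the norm bound\<close>

lemma dist_of_fun_diff:
  assumes "locally_integrable F" "locally_integrable G"
  shows "dist_of_fun (\<lambda>x. F x - G x) = dist_of_fun F - dist_of_fun G"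
proof -
  \<comment> \<open>This keeps all three instances of \<open>dist_of_fun\<close> off its junk
    value.\<close>
  have "locally_integrable (\<lambda>x. F x - G x)"
    using assms unfolding locally_integrable_def by auto
  then show ?thesis
    using assms
    by (auto simp: dist_apply_inject[symmetric] minus_distribution.rep_eq dist_of_fun.rep_eq fun_eq_iff
        left_diff_distrib integrable_mult_tf)
qed

lemma dist_deriv_diff: "dist_deriv (S - T) = dist_deriv S - dist_deriv T"
  by (auto simp: dist_apply_inject[symmetric] minus_distribution.rep_eq dist_deriv.rep_eq fun_eq_iff)

lemma is_primitive_diff:
  assumes "is_primitive F f" "is_primitive G g"
  shows "is_primitive (\<lambda>x. F x - G x) (f - g)"
proof -
  have F: "F \<in> B_C" "F \<in> C0_ereal" and G: "G \<in> B_C" "G \<in> C0_ereal"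
    using assms by (auto simp: is_primitive_def B_C_def)
  then have "(\<lambda>x. F x - G x) \<in> C0_ereal"
    unfolding C0_ereal_def by (auto intro!: continuous_on_diff tendsto_diff)
  with F G assms show ?thesis
    by (simp add: is_primitive_def dist_of_fun_diff dist_deriv_diff locally_integrable_C0_ereal B_C_def)
qed

text \<open>Two primitives of \<open>f\<close> differ by a primitive of 0, which vanishes; hence the
  definite description in \<open>primitive\<close> denotes.\<close>

lemma primitive_eq:
  assumes "is_primitive F f"
  shows "primitive f = F"
  unfolding primitive_def
proof (rule the_equality)
  show "is_primitive F f" by (rule assms)
  fix G assume "is_primitive G f"
  from is_primitive_diff[OF this assms] have "G x - F x = 0" for x
    using is_primitive_zero_imp[where F = "\<lambda>x. G x - F x"] by simp
  then show "G = F" by (simp add: fun_eq_iff)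
qed

lemma is_primitive_primitive: "f \<in> A_C \<Longrightarrow> is_primitive (primitive f) f"
  using primitive_eq by (auto simp: A_C_def)

lemma primitive_diff:
  "f \<in> A_C \<Longrightarrow> g \<in> A_C \<Longrightarrow> primitive (f - g) = (\<lambda>x. primitive f x - primitive g x)"
  by (intro primitive_eq is_primitive_diff is_primitive_primitive)

lemma A_C_diff: "f \<in> A_C \<Longrightarrow> g \<in> A_C \<Longrightarrow> f - g \<in> A_C"
  unfolding A_C_def using is_primitive_diff by blast

lemma cp_integral_diff: "f \<in> A_C \<Longrightarrow> g \<in> A_C \<Longrightarrow> cp_integral (f - g) = cp_integral f - cp_integral g"
  by (simp add: cp_integral_def primitive_diff)

text \<open>A real-valued \<open>SUP\<close> is an upper bound only for a bounded family, hence the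
  appeal to boundedness of the primitive.\<close>

lemma abs_primitive_le_norm:
  assumes "f \<in> A_C"
  shows "\<bar>primitive f x\<bar> \<le> alexiewicz_norm f"
proof -
  have "primitive f \<in> C0_ereal"
    using is_primitive_primitive[OF assms] by (simp add: is_primitive_def B_C_def)
  then have "bdd_above (range (\<lambda>x. \<bar>primitive f x\<bar>))"
    using C0_ereal_bounded by (auto simp: bdd_above_def)
  then show ?thesis
    unfolding alexiewicz_norm_def by (rule cSUP_upper[OF UNIV_I])
qed

section \<open>Integration against a constant\<close>

lemma has_RS_integral_const: "has_RS_integral F (\<lambda>_. c) a b 0"
  by (auto simp: has_RS_integral_def intro: exI[of _ 1])

text \<open>One partition fine enough for both limits forces them together. For \<open>a > b\<close>
  there is no partition at all and every number would qualify vacuously.\<close>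

lemma has_RS_integral_unique:
  assumes "has_RS_integral F g a b I" "has_RS_integral F g a b J" "a \<le> b"
  shows "I = J"
proof (rule ccontr)
  assume "I \<noteq> J"
  define e where "e = \<bar>I - J\<bar> / 2"
  have e: "e > 0" using \<open>I \<noteq> J\<close> by (simp add: e_def)
  let ?S = "\<lambda>(n::nat) x t. \<Sum>i<n. F (t i) * (g (x (Suc i)) - g (x i))"
  let ?P = "\<lambda>d (n::nat) x t. x 0 = a \<and> x n = b \<and>
        (\<forall>i<n. x i \<le> x (Suc i) \<and> x (Suc i) - x i < d \<and> t i \<in> {x i..x (Suc i)})"
  obtain d1 where d1: "d1 > 0" "\<And>n x t. ?P d1 n x t \<Longrightarrow> \<bar>?S n x t - I\<bar> < e"
    using assms(1)[unfolded has_RS_integral_def, rule_format, OF e] by blast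
  obtain d2 where d2: "d2 > 0" "\<And>n x t. ?P d2 n x t \<Longrightarrow> \<bar>?S n x t - J\<bar> < e"
    using assms(2)[unfolded has_RS_integral_def, rule_format, OF e] by blast
  define d where "d = min d1 d2"
  have "d > 0" using d1 d2 by (simp add: d_def)
  \<comment> \<open>The number of equal pieces that brings the mesh below \<open>d\<close>; the
    strict inequality makes it positive even when \<open>a = b\<close>.\<close>
  obtain n where n: "real n > (b - a) / d"
    using reals_Archimedean2 by blast
  have "real n \<ge> 0" "(b - a) / d \<ge> 0" using assms(3) \<open>d > 0\<close> by auto
  then have n0: "real n > 0" using n by linarith
  define x where "x i = a + real i * ((b - a) / real n)" for i
  have diff: "x (Suc i) - x i = (b - a) / real n" for i
    by (simp add: x_def distrib_right add_divide_distrib)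
  have "(b - a) / real n < d"
    using n n0 \<open>d > 0\<close> by (simp add: field_simps)
  moreover have "(b - a) / real n \<ge> 0"
    using assms(3) n0 by simp
  then have "x i \<le> x (Suc i)" for i
    using diff[of i] by linarith
  moreover have "x 0 = a" "x n = b"
    using n0 by (auto simp: x_def)
  ultimately have "\<bar>?S n x x - I\<bar> < e" "\<bar>?S n x x - J\<bar> < e"
    \<comment> \<open>The left end points serve as tags.\<close>
    using d1(2)[of x n x] d2(2)[of x n x] diff by (auto simp: d_def)
  then have "\<bar>I - J\<bar> < e + e"
    by linarith
  then show False
    by (simp add: e_def)
qed

lemma RS_integral_const: "a \<le> b \<Longrightarrow> RS_integral F (\<lambda>_. c) a b = 0"
  unfolding RS_integral_def
  by (rule the_equality) (auto intro: has_RS_integral_unique has_RS_integral_const)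

lemma RS_integral_ereal_const: "RS_integral_ereal F (\<lambda>_. c) = 0"
proof -
  \<comment> \<open>\<open>RS_integral\<close> is known to vanish only for \<open>A \<le> B\<close>;
    separating the two variables by 0 secures this eventually along the product filter.\<close>
  have "eventually (\<lambda>A. A \<le> (0::real)) at_bot" "eventually (\<lambda>B. B \<ge> (0::real)) at_top"
    by (rule eventually_le_at_bot eventually_ge_at_top)+
  then have "eventually (\<lambda>p. (\<lambda>A. A \<le> (0::real)) (fst p) \<and> (\<lambda>B. B \<ge> (0::real)) (snd p)) (at_bot \<times>\<^sub>F at_top)"
    by (rule eventually_prodI)
  then have "eventually (\<lambda>(A, B). RS_integral (\<lambda>x. F (ereal x)) (\<lambda>x. c) A B = 0) (at_bot \<times>\<^sub>F at_top)"
    by eventually_elim (auto intro: RS_integral_const)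
  then have "((\<lambda>(A, B). RS_integral (\<lambda>x. F (ereal x)) (\<lambda>x. c) A B) \<longlongrightarrow> 0) (at_bot \<times>\<^sub>F at_top)"
    by (intro tendsto_eventually) (simp add: case_prod_unfold)
  then have "Lim (at_bot \<times>\<^sub>F at_top) (\<lambda>(A, B). RS_integral (\<lambda>x. F (ereal x)) (\<lambda>x. c) A B) = 0"
    by (intro tendsto_Lim) (simp_all add: prod_filter_eq_bot)
  moreover have "Lim at_top (\<lambda>x::real. c) = c" "Lim at_bot (\<lambda>x::real. c) = c"
    by (simp_all add: tendsto_Lim)
  ultimately show ?thesis
    by (simp add: RS_integral_ereal_def)
qed

text \<open>A constant has no increments and no jumps, so only the boundary term at
  \<open>\<infinity>\<close> survives. This is the link from weak convergence in \<open>BV\<close>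
  to the integrals.\<close>

lemma cp_integral_mult_one: "cp_integral_mult f (\<lambda>_. 1) = cp_integral f"
  by (simp add: cp_integral_mult_def cp_integral_def RS_integral_ereal_const)

lemma const_in_BV: "(\<lambda>_. c) \<in> BV"
  by (auto simp: BV_def)

section \<open>The counterexamples\<close>

text \<open>The tent is centred at 2 because \<^const>\<open>real_of_ereal\<close> is 0 at the infinite points.\<close>

definition tent :: "ereal \<Rightarrow> real" where
  "tent x = max 0 (1 - \<bar>real_of_ereal x - 2\<bar>)"

text \<open>The infinite points are treated apart because \<open>real_of_ereal\<close> sends both to
  0. Increasing \<open>c\<close> pushes the rise out of every bounded set but leaves the value at
  \<open>\<infinity>\<close> unchanged.\<close>

definition ramp :: "real \<Rightarrow> ereal \<Rightarrow> real" where
  "ramp c x = (if x = \<infinity> then 1 else if x = -\<infinity> then 0 else max 0 (min 1 (real_of_ereal x - c)))"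

lemma scaled_tent_in_B_C: "(\<lambda>x. c * tent x) \<in> B_C"
proof -
  have "eventually (\<lambda>x. c * tent (ereal x) = 0) at_top"
    using eventually_ge_at_top[of 3] by eventually_elim (auto simp: tent_def)
  moreover have "eventually (\<lambda>x. c * tent (ereal x) = 0) at_bot"
    using eventually_le_at_bot[of 1] by eventually_elim (auto simp: tent_def)
  ultimately show ?thesis
    unfolding B_C_def C0_ereal_def
    by (auto simp: tent_def intro!: continuous_intros tendsto_eventually)
qed

lemma ramp_in_B_C: "ramp c \<in> B_C"
proof -
  have "eventually (\<lambda>x. ramp c (ereal x) = 1) at_top"
    using eventually_ge_at_top[of "c + 1"] by eventually_elim (auto simp: ramp_def)
  moreover have "eventually (\<lambda>x. ramp c (ereal x) = 0) at_bot"
    using eventually_le_at_bot[of c] by eventually_elim (auto simp: ramp_def)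
  ultimately show ?thesis
    unfolding B_C_def C0_ereal_def
    by (auto simp: ramp_def intro!: continuous_intros tendsto_eventually)
qed

definition tent_deriv :: "real \<Rightarrow> distribution" where
  "tent_deriv c = dist_deriv (dist_of_fun (\<lambda>x. c * tent (ereal x)))"

definition ramp_deriv :: "real \<Rightarrow> distribution" where
  "ramp_deriv c = dist_deriv (dist_of_fun (\<lambda>x. ramp c (ereal x)))"

lemma is_primitive_tent: "is_primitive (\<lambda>x. c * tent x) (tent_deriv c)"
  using scaled_tent_in_B_C by (simp add: is_primitive_def tent_deriv_def)

lemma is_primitive_ramp: "is_primitive (ramp c) (ramp_deriv c)"
  using ramp_in_B_C by (simp add: is_primitive_def ramp_deriv_def)

lemma tent_deriv_in_A_C: "tent_deriv c \<in> A_C"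
  using is_primitive_tent by (auto simp: A_C_def)

lemma ramp_deriv_in_A_C: "ramp_deriv c \<in> A_C"
  using is_primitive_ramp by (auto simp: A_C_def)

lemma zero_in_A_C: "0 \<in> A_C"
  using A_C_diff[OF tent_deriv_in_A_C tent_deriv_in_A_C, of 0 0] by simp

lemma primitive_zero: "primitive 0 = (\<lambda>_. 0)"
  using primitive_diff[OF zero_in_A_C zero_in_A_C] by simp

lemma cp_integral_zero: "cp_integral 0 = 0"
  by (simp add: cp_integral_def primitive_zero)

lemma cp_integral_tent_deriv: "cp_integral (tent_deriv c) = 0"
  using primitive_eq[OF is_primitive_tent[of c]] by (simp add: cp_integral_def tent_def)

lemma cp_integral_ramp_deriv: "cp_integral (ramp_deriv c) = 1"
  using primitive_eq[OF is_primitive_ramp[of c]] by (simp add: cp_integral_def ramp_def)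

text \<open>The norm is bounded below by the value at the peak, the point 2.\<close>

lemma alexiewicz_norm_tent_deriv_ge: "alexiewicz_norm (tent_deriv 1) \<ge> 1"
  using abs_primitive_le_norm[OF tent_deriv_in_A_C[of 1], of 2] primitive_eq[OF is_primitive_tent[of 1]]
  by (simp add: tent_def)

text \<open>Once \<open>n\<close> passes the support of \<open>\<phi>\<close>, the ramp vanishes
  wherever \<open>deriv (tf_apply \<phi>)\<close> does not, so the pairing is exactly 0. The unit
  mass escapes to infinity, unseen by test functions.\<close>

lemma weakly_tendsto_ramp_deriv: "weakly_tendsto_D (\<lambda>n. ramp_deriv (real n)) 0"
  unfolding weakly_tendsto_D_def
proof
  fix \<phi>
  have "bounded (support (tf_apply \<phi>))"
    using tf_apply[of \<phi>] by (intro compact_imp_bounded) simp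
  then obtain B where B: "\<And>x. x \<in> support (tf_apply \<phi>) \<Longrightarrow> \<bar>x\<bar> \<le> B"
    unfolding bounded_iff by auto
  have "dist_apply (ramp_deriv (real n) - 0) \<phi> = 0" if "real n \<ge> B" for n
  proof -
    have "ramp (real n) (ereal x) * deriv (tf_apply \<phi>) x = 0" for x
    proof (cases "x \<le> real n")
      case False
      then have "x \<notin> support (deriv (tf_apply \<phi>))"
        using that B support_deriv by fastforce
      then show ?thesis
        by (simp add: zero_outside_support)
    qed (simp add: ramp_def)
    moreover have "ramp (real n) \<in> C0_ereal"
      using ramp_in_B_C by (simp add: B_C_def)
    ultimately have "dist_apply (ramp_deriv (real n)) \<phi> = - (LINT x|(lborel :: real measure). 0)"
      by (simp only: ramp_deriv_def dist_apply_deriv_fun)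
    then show ?thesis by simp
  qed
  moreover have "eventually (\<lambda>n. real n \<ge> B) sequentially"
    using filterlim_real_sequentially by (simp add: filterlim_at_top)
  ultimately show "(\<lambda>n. dist_apply (ramp_deriv (real n) - 0) \<phi>) \<longlonglongrightarrow> 0"
    by (intro tendsto_eventually) (auto elim: eventually_mono)
qed

lemma dist_apply_tent_deriv: "dist_apply (tent_deriv c) \<phi> = c * dist_apply (tent_deriv 1) \<phi>"
proof -
  have "(\<lambda>x. c * tent x) \<in> C0_ereal" for c
    using scaled_tent_in_B_C by (simp add: B_C_def)
  from dist_apply_deriv_fun[OF this[of c]] dist_apply_deriv_fun[OF this[of 1]] show ?thesis
    by (simp add: tent_deriv_def mult.assoc)
qed

text \<open>Yields a test function with nonzero pairing without exhibiting one: the norm of 0 is 0,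
  that of the tent derivative is at least 1.\<close>

lemma tent_deriv_nonzero: "tent_deriv 1 \<noteq> 0"
  using alexiewicz_norm_tent_deriv_ge by (auto simp: alexiewicz_norm_def primitive_zero)

text \<open>Against a suitable test function the pairing is linear in \<open>n\<close> with nonzero
  slope. A limit would, after division by the slope, make \<open>real\<close> itself
  converge.\<close>

lemma not_weakly_tendsto_tent_deriv: "\<not> weakly_tendsto_D (\<lambda>n. tent_deriv (real n)) f"
proof
  assume conv: "weakly_tendsto_D (\<lambda>n. tent_deriv (real n)) f"
  obtain \<phi> where \<phi>: "dist_apply (tent_deriv 1) \<phi> \<noteq> 0"
    using tent_deriv_nonzero by (auto simp: dist_apply_inject[symmetric] zero_distribution.rep_eq)
  have "dist_apply (tent_deriv (real n) - f) \<phi> = real n * dist_apply (tent_deriv 1) \<phi> - dist_apply f \<phi>" for n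
    by (simp only: minus_distribution.rep_eq dist_apply_tent_deriv[of "real n"])
  moreover have "(\<lambda>n. dist_apply (tent_deriv (real n) - f) \<phi>) \<longlonglongrightarrow> 0"
    using conv by (simp add: weakly_tendsto_D_def)
  ultimately have "(\<lambda>n. real n * dist_apply (tent_deriv 1) \<phi> - dist_apply f \<phi>) \<longlonglongrightarrow> 0"
    by (simp only:)
  from tendsto_add[OF this tendsto_const[of "dist_apply f \<phi>"]]
  have "(\<lambda>n. real n * dist_apply (tent_deriv 1) \<phi>) \<longlonglongrightarrow> dist_apply f \<phi>"
    by simp
  from tendsto_divide[OF this tendsto_const[of "dist_apply (tent_deriv 1) \<phi>"] \<phi>]
  have "real \<longlonglongrightarrow> dist_apply f \<phi> / dist_apply (tent_deriv 1) \<phi>"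
    using \<phi> by simp
  then show False
    using filterlim_real_sequentially not_tendsto_and_filterlim_at_infinity[OF sequentially_bot]
      filterlim_at_top_imp_at_infinity by blast
qed

theorem theorem14:
  shows
    "(\<forall>(f :: nat \<Rightarrow> distribution) f'. range f \<subseteq> A_C \<and> f' \<in> A_C \<longrightarrow>
        (\<lambda>n. alexiewicz_norm (f n - f')) \<longlonglongrightarrow> 0 \<longrightarrow>
        (\<lambda>n. cp_integral (f n)) \<longlonglongrightarrow> cp_integral f')
   \<and> (\<exists>(f :: nat \<Rightarrow> distribution) f'. range f \<subseteq> A_C \<and> f' \<in> A_C \<and>
        (\<lambda>n. cp_integral (f n)) \<longlonglongrightarrow> cp_integral f' \<and>
        \<not> (\<lambda>n. alexiewicz_norm (f n - f')) \<longlonglongrightarrow> 0)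
   \<and> (\<forall>(f :: nat \<Rightarrow> distribution) f'. range f \<subseteq> A_C \<and> f' \<in> A_C \<longrightarrow>
        weakly_tendsto_BV f f' \<longrightarrow>
        (\<lambda>n. cp_integral (f n)) \<longlonglongrightarrow> cp_integral f')
   \<and> (\<exists>(f :: nat \<Rightarrow> distribution) f'. range f \<subseteq> A_C \<and> f' \<in> A_C \<and>
        weakly_tendsto_D f f' \<and>
        \<not> (\<lambda>n. cp_integral (f n)) \<longlonglongrightarrow> cp_integral f')
   \<and> (\<exists>f :: nat \<Rightarrow> distribution. range f \<subseteq> A_C \<and>
        \<not> (\<exists>f'. weakly_tendsto_D f f') \<and>
        convergent (\<lambda>n. cp_integral (f n)))"
proof (intro conjI)
  \<comment> \<open>Common to the two positive claims: by linearity it is enough that the integrals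
    of the differences tend to 0.\<close>
  have *: "(\<lambda>n. cp_integral (f n)) \<longlonglongrightarrow> cp_integral f'"
    if "range f \<subseteq> A_C" "f' \<in> A_C" "(\<lambda>n. cp_integral (f n - f')) \<longlonglongrightarrow> 0" for f :: "nat \<Rightarrow> distribution" and f'
    using that by (subst LIM_zero_iff[symmetric]) (simp add: cp_integral_diff image_subset_iff)
  show "\<forall>(f :: nat \<Rightarrow> distribution) f'. range f \<subseteq> A_C \<and> f' \<in> A_C \<longrightarrow>
        (\<lambda>n. alexiewicz_norm (f n - f')) \<longlonglongrightarrow> 0 \<longrightarrow> (\<lambda>n. cp_integral (f n)) \<longlonglongrightarrow> cp_integral f'"
  proof (intro allI impI)
    fix f :: "nat \<Rightarrow> distribution" and f'
    assume f: "range f \<subseteq> A_C \<and> f' \<in> A_C" and lim: "(\<lambda>n. alexiewicz_norm (f n - f')) \<longlonglongrightarrow> 0"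
    have "norm (cp_integral (f n - f')) \<le> alexiewicz_norm (f n - f')" for n
      using abs_primitive_le_norm[OF A_C_diff, of "f n" f' \<infinity>] f by (auto simp: cp_integral_def)
    then have "(\<lambda>n. cp_integral (f n - f')) \<longlonglongrightarrow> 0"
      by (intro Lim_null_comparison[OF _ lim] always_eventually) simp
    then show "(\<lambda>n. cp_integral (f n)) \<longlonglongrightarrow> cp_integral f'"
      using * f by blast
  qed
  show "\<exists>(f :: nat \<Rightarrow> distribution) f'. range f \<subseteq> A_C \<and> f' \<in> A_C \<and>
        (\<lambda>n. cp_integral (f n)) \<longlonglongrightarrow> cp_integral f' \<and> \<not> (\<lambda>n. alexiewicz_norm (f n - f')) \<longlonglongrightarrow> 0"
    using tent_deriv_in_A_C zero_in_A_C alexiewicz_norm_tent_deriv_ge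
    by (intro exI[of _ "\<lambda>_. tent_deriv 1"] exI[of _ 0])
      (auto simp: cp_integral_tent_deriv cp_integral_zero tendsto_const_iff)
  show "\<forall>(f :: nat \<Rightarrow> distribution) f'. range f \<subseteq> A_C \<and> f' \<in> A_C \<longrightarrow>
        weakly_tendsto_BV f f' \<longrightarrow> (\<lambda>n. cp_integral (f n)) \<longlonglongrightarrow> cp_integral f'"
    \<comment> \<open>The constant 1 is the only integrator tested here.\<close>
    using * const_in_BV[of 1] cp_integral_mult_one by (force simp: weakly_tendsto_BV_def)
  show "\<exists>(f :: nat \<Rightarrow> distribution) f'. range f \<subseteq> A_C \<and> f' \<in> A_C \<and>
        weakly_tendsto_D f f' \<and> \<not> (\<lambda>n. cp_integral (f n)) \<longlonglongrightarrow> cp_integral f'"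
    using ramp_deriv_in_A_C zero_in_A_C weakly_tendsto_ramp_deriv
    by (intro exI[of _ "\<lambda>n. ramp_deriv (real n)"] exI[of _ 0])
      (auto simp: cp_integral_ramp_deriv cp_integral_zero tendsto_const_iff)
  show "\<exists>f :: nat \<Rightarrow> distribution. range f \<subseteq> A_C \<and>
        \<not> (\<exists>f'. weakly_tendsto_D f f') \<and> convergent (\<lambda>n. cp_integral (f n))"
    using tent_deriv_in_A_C not_weakly_tendsto_tent_deriv
    by (intro exI[of _ "\<lambda>n. tent_deriv (real n)"]) (auto simp: cp_integral_tent_deriv convergent_const)
qed

end
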